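(* Let $p\geq 5$ be a prime. Then $$\left[\begin{array}{l}p\\3\end{array}\right]\equiv\Big(p\,B_{p-1}-p\Big)\,p\,\frac{B_{p-3}}{p-3}-\frac{p^2}{2}\sum_{a=1}^{p-1}\frac{q_a^2}{a^2}\pmod{p^3}.$$
   Context: Here $\left[\begin{array}{l}p\\3\end{array}\right]$ denotes the unsigned Stirling number of the first kind (the number of permutations of $p$ letters that decompose into a product of $3$ disjoint cycles), $B_n$ are the Bernoulli numbers, $q_a=\frac{a^{p-1}-1}{p}$ is the Fermat quotient in base $a$, and congruences are taken in $\mathbb{Z}_p$ (the $p$-adic integers).
   Formalization: The congruence is stated for primes p ≥ 7 instead of p ≥ 5, because it fails at p = 5: the left side is 35, the right side is −232115/96, and their difference 5²·9419/96 is not divisible by 5³. *)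

theory Defs
  imports "HOL-Combinatorics.Stirling" "HOL-Computational_Algebra.Primes"
    "HOL-Computational_Algebra.Formal_Power_Series"
begin

(* Convention B_1 = -1/2; the recurrence is sum (k \<le> n) binom(n+1,k) B_k = 0 for n \<ge> 1. *)
fun bernoulli :: "nat \<Rightarrow> rat" where
  "bernoulli 0 = 1"
| "bernoulli (Suc n) =
     - (\<Sum>k\<le>n. of_nat (Suc (Suc n) choose k) * bernoulli k) / of_nat (Suc (Suc n))"

declare bernoulli.simps(2) [simp del]

lemma bernoulli_egf:
  "Abs_fps (\<lambda>n. bernoulli n / fact n) = fps_X / (fps_exp 1 - 1)"
proof -
  let ?B = "Abs_fps (\<lambda>n. bernoulli n / fact n)"
  let ?E = "fps_exp 1 - 1 :: rat fps"
  have rec: "(\<Sum>k\<le>Suc n. of_nat (Suc (Suc n) choose k) * bernoulli k) = 0" for n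
    by (simp add: bernoulli.simps(2))
  have "?B * ?E = fps_X"
  proof (rule fps_ext)
    fix n
    show "fps_nth (?B * ?E) n = fps_nth fps_X n"
    proof (cases n)
      case 0
      then show ?thesis by simp
    next
      case (Suc m)
      have "fps_nth (?B * ?E) n = (\<Sum>k\<le>m. bernoulli k / fact k * (1 / fact (Suc m - k)))"
        unfolding fps_mult_nth Suc
        by (simp add: atLeast0AtMost)
           (intro sum.cong refl, auto)
      also have "\<dots> = (\<Sum>k\<le>m. of_nat (Suc m choose k) * bernoulli k) / fact (Suc m)"
        unfolding sum_divide_distrib
        by (intro sum.cong refl) (simp add: binomial_fact field_simps del: fact_Suc)
      also have "\<dots> = fps_nth fps_X n"
      proof (cases m)
        case 0
        then show ?thesis using Suc by simp
      next
        case (Suc l)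
        then show ?thesis using rec[of l] \<open>n = Suc m\<close> by (simp del: binomial_Suc_Suc sum.atMost_Suc)
      qed
      finally show ?thesis .
    qed
  qed
  moreover have "?E \<noteq> 0"
  proof
    assume "?E = 0"
    then have "fps_nth ?E 1 = 0" by (simp only: fps_zero_nth)
    then show False by simp
  qed
  ultimately show ?thesis
    by (metis nonzero_mult_div_cancel_right)
qed

definition fermat_quotient :: "nat \<Rightarrow> nat \<Rightarrow> rat" where
  "fermat_quotient p a = (of_nat a ^ (p - 1) - 1) / of_nat p"

(* The intersection of the rationals with the ring of p-adic integers. *)
definition p_integral :: "nat \<Rightarrow> rat set" where
  "p_integral p = {x. \<not> int p dvd snd (quotient_of x)}"

(* For rational x, y this is the congruence x = y (mod m) in the ring of p-adic integers;
   in particular both sides have to be p-adic integers. *)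
definition padic_cong :: "nat \<Rightarrow> nat \<Rightarrow> rat \<Rightarrow> rat \<Rightarrow> bool" where
  "padic_cong p m x y \<longleftrightarrow> x \<in> p_integral p \<and> y \<in> p_integral p \<and>
     (\<exists>z \<in> p_integral p. x - y = of_nat m * z)"

lemma bernoulli_2: "bernoulli 2 = 1/6"
  by (simp add: numeral_eq_Suc bernoulli.simps)

lemma bernoulli_4: "bernoulli 4 = -1/30"
  by (simp add: numeral_eq_Suc bernoulli.simps)

(* The hypothesis p \<ge> 7 of the main theorem cannot be relaxed to p \<ge> 5: for p = 5 the
   two sides are 35 and -232115/96, which are congruent modulo 5^2 but not modulo 5^3. *)
lemma fails_for_5:
  "\<not> padic_cong 5 (5 ^ 3) (of_nat (stirling 5 3))
     ((of_nat 5 * bernoulli (5 - 1) - of_nat 5) * of_nat 5 * (bernoulli (5 - 3) / (of_nat 5 - 3))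
      - of_nat 5 ^ 2 / 2 * (\<Sum>a = 1..5 - 1. (fermat_quotient 5 a)\<^sup>2 / (of_nat a)\<^sup>2))"
    (is "\<not> padic_cong _ _ _ ?R")
proof
  have S: "stirling 5 3 = 35"
    by (simp add: numeral_eq_Suc)
  have I: "{Suc 0..4} = {1, 2, 3, 4}" by auto
  have R: "?R = - 232115 / 96"
    by (simp add: bernoulli_2 bernoulli_4 fermat_quotient_def I)
  assume "padic_cong 5 (5 ^ 3) (of_nat (stirling 5 3)) ?R"
  then obtain z where z: "z \<in> p_integral 5" and "(35::rat) - (- 232115 / 96) = 5 ^ 3 * z"
    unfolding padic_cong_def R S by auto
  then have "z = 9419 / 480" by simp
  then have "z = Rat.Fract 9419 480" by (simp add: Fract_of_int_quotient)
  then have "snd (quotient_of z) = 480"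
    by (simp add: quotient_of_Fract Rat.normalize_def Let_def gcd_non_0_int)
  with z show False
    by (simp add: p_integral_def)
qed

end

theory Submission
  imports Defs "HOL-Number_Theory.Residues"
begin

text \<open>
  Write $H_k = \sum_{a<p} a^{-k}$ and $u_a = a^{p-1} = 1 + p q_a$. The Stirling number is
  $(p-1)!\,(H_1^2 - H_2)/2$, where $H_1^2$ vanishes modulo $p^3$ and $(p-1)! \equiv p B_{p-1} - p$
  modulo $p^2$, so everything rests on $H_2$ modulo $p^3$. The identities
  $1 = 2u - u^2 + (u-1)^2$ and $u(u-1)^2 = u^3 - 2u^2 + u$, divided by $a^2$ and summed,
  express $H_2$ and $\sum q_a^2/a^2$ through the power sums of exponents $m_j = p - 3 + j(p-1)$,
  $j \le 2$, that is, through $p B_{m_j}$. The claim thus becomes a statement on the numbers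
  $\beta_j = B_{m_j}/m_j$, namely $\beta_1 \equiv \beta_0$ modulo $p$ and
  $\beta_2 - 2\beta_1 + \beta_0 \equiv 0$ modulo $p^2$. These Kummer congruences hold because
  $2(1 - 2^m) B_m/m$ is the value at $0$ of an Euler polynomial, hence congruent modulo $p^2$
  to the alternating power sum $\sum_{a<p} (-1)^a a^{m-1}$, whose second difference is
  visibly divisible by $p^2$.
\<close>

section \<open>Congruences between $p$-integral rationals\<close>

text \<open>The denominator returned by \<open>quotient_of\<close> is reduced, hence divides every
  other denominator of \<open>x\<close>. Any fraction with denominator prime to \<open>p\<close> can
  therefore serve as witness, which makes the closure properties easy.\<close>

lemma p_integral_iff:
  assumes "prime p"
  shows "x \<in> p_integral p \<longleftrightarrow> (\<exists>a b. \<not> int p dvd b \<and> x = of_int a / of_int b)"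
proof
  assume "x \<in> p_integral p"
  moreover obtain a b where ab: "quotient_of x = (a, b)" by fastforce
  ultimately show "\<exists>a b. \<not> int p dvd b \<and> x = of_int a / of_int b"
    using quotient_of_div[OF ab] by (auto simp: p_integral_def)
next
  assume "\<exists>a b. \<not> int p dvd b \<and> x = of_int a / of_int b"
  then obtain a b where ab: "\<not> int p dvd b" "x = of_int a / of_int b" by blast
  obtain c d where cd: "quotient_of x = (c, d)" by fastforce
  have x: "x = of_int c / of_int d" and "d > 0" and "coprime c d"
    using quotient_of_div[OF cd] quotient_of_denom_pos[OF cd] quotient_of_coprime[OF cd] by auto
  have "b \<noteq> 0" using ab(1) by auto
  have "(of_int (c * b) :: rat) = of_int (a * d)"
    using x ab(2) \<open>d > 0\<close> \<open>b \<noteq> 0\<close> by (simp add: field_simps)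
  then have "c * b = a * d" by (simp only: of_int_eq_iff)
  then have "d dvd b" using \<open>coprime c d\<close>
    by (metis coprime_commute coprime_dvd_mult_right_iff dvd_triv_right)
  then show "x \<in> p_integral p"
    using ab(1) cd dvd_trans by (auto simp: p_integral_def)
qed

context
  fixes p :: nat
  assumes p: "prime p"
begin

lemma p_integral_of_int [simp, intro]: "of_int a \<in> p_integral p"
  using p prime_gt_1_nat[OF p] by (auto simp: p_integral_def)

lemma p_integral_of_nat [simp, intro]: "of_nat a \<in> p_integral p"
  using p_integral_of_int[of "int a"] by simp

lemma p_integral_numeral [simp, intro]: "numeral a \<in> p_integral p"
  using p_integral_of_nat[of "numeral a"] by simp

lemma p_integral_0 [simp, intro]: "0 \<in> p_integral p"
  using p_integral_of_nat[of 0] by simp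

lemma p_integral_1 [simp, intro]: "1 \<in> p_integral p"
  using p_integral_of_nat[of 1] by simp

lemma p_integral_add [simp, intro]:
  assumes "x \<in> p_integral p" "y \<in> p_integral p"
  shows "x + y \<in> p_integral p"
proof -
  obtain a b c d where "\<not> int p dvd b" "x = of_int a / of_int b"
    and "\<not> int p dvd d" "y = of_int c / of_int d"
    using assms p_integral_iff[OF p] by meson
  moreover from this have "b \<noteq> 0" "d \<noteq> 0" by auto
  ultimately have "\<not> int p dvd b * d \<and> x + y = of_int (a * d + c * b) / of_int (b * d)"
    using p by (auto simp: prime_dvd_mult_iff add_frac_eq)
  then show ?thesis using p_integral_iff[OF p] by blast
qed

lemma p_integral_mult [simp, intro]:
  assumes "x \<in> p_integral p" "y \<in> p_integral p"
  shows "x * y \<in> p_integral p"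
proof -
  obtain a b c d where "\<not> int p dvd b" "x = of_int a / of_int b"
    and "\<not> int p dvd d" "y = of_int c / of_int d"
    using assms p_integral_iff[OF p] by meson
  then have "\<not> int p dvd b * d \<and> x * y = of_int (a * c) / of_int (b * d)"
    using p by (auto simp: prime_dvd_mult_iff)
  then show ?thesis using p_integral_iff[OF p] by blast
qed

lemma p_integral_uminus [simp, intro]: "x \<in> p_integral p \<Longrightarrow> - x \<in> p_integral p"
  using p_integral_mult[OF p_integral_of_int[of "-1"], of x] by simp

lemma p_integral_diff [simp, intro]:
  "x \<in> p_integral p \<Longrightarrow> y \<in> p_integral p \<Longrightarrow> x - y \<in> p_integral p"
  using p_integral_add[of x "- y"] by (auto simp del: p_integral_add)

lemma p_integral_power [simp, intro]: "x \<in> p_integral p \<Longrightarrow> x ^ n \<in> p_integral p"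
  by (induction n) auto

lemma p_integral_sum [intro]:
  "(\<And>i. i \<in> A \<Longrightarrow> f i \<in> p_integral p) \<Longrightarrow> sum f A \<in> p_integral p"
  by (induction A rule: infinite_finite_induct) auto

lemma p_integral_divide_nat [intro]:
  assumes "x \<in> p_integral p" "\<not> p dvd n"
  shows "x / of_nat n \<in> p_integral p"
proof -
  have "of_int 1 / of_int (int n) \<in> p_integral p"
    using assms(2) p_integral_iff[OF p] int_dvd_int_iff by blast
  from p_integral_mult[OF assms(1) this] show ?thesis by simp
qed

lemma p_integral_divide_int:
  assumes "x \<in> p_integral p" "\<not> int p dvd n"
  shows "x / of_int n \<in> p_integral p"
proof -
  have "of_int 1 / of_int n \<in> p_integral p"
    using assms(2) p_integral_iff[OF p] by blast
  from p_integral_mult[OF assms(1) this] show ?thesis by simp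
qed

text \<open>Unlike in \<open>padic_cong\<close>, the two sides themselves may fail to be p-integral:
  only the difference matters, so congruences chain and add freely.\<close>

definition pcong :: "nat \<Rightarrow> rat \<Rightarrow> rat \<Rightarrow> bool" where
  "pcong k x y \<longleftrightarrow> (\<exists>z\<in>p_integral p. x - y = of_nat p ^ k * z)"

lemma pcongI: "z \<in> p_integral p \<Longrightarrow> x - y = of_nat p ^ k * z \<Longrightarrow> pcong k x y"
  by (auto simp: pcong_def)

lemma pcongE:
  assumes "pcong k x y"
  obtains z where "z \<in> p_integral p" "x = y + of_nat p ^ k * z"
  using assms by (auto simp: pcong_def algebra_simps)

lemma pcong_refl [simp, intro]: "pcong k x x"
  by (rule pcongI[of 0]) auto

lemma pcong_sym: "pcong k x y \<Longrightarrow> pcong k y x"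
  by (erule pcongE, rule pcongI[of "- z" for z]) auto

lemma pcong_trans [trans]:
  assumes "pcong k x y" "pcong k y u"
  shows "pcong k x u"
proof -
  obtain z where z: "z \<in> p_integral p" "x = y + of_nat p ^ k * z"
    using assms(1) by (rule pcongE)
  obtain w where w: "w \<in> p_integral p" "y = u + of_nat p ^ k * w"
    using assms(2) by (rule pcongE)
  show ?thesis
    using z w by (intro pcongI[of "z + w"]) (auto simp: algebra_simps)
qed

lemma pcong_add:
  assumes "pcong k x y" "pcong k x' y'"
  shows "pcong k (x + x') (y + y')"
proof -
  obtain z where z: "z \<in> p_integral p" "x = y + of_nat p ^ k * z"
    using assms(1) by (rule pcongE)
  obtain w where w: "w \<in> p_integral p" "x' = y' + of_nat p ^ k * w"
    using assms(2) by (rule pcongE)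
  show ?thesis
    using z w by (intro pcongI[of "z + w"]) (auto simp: algebra_simps)
qed

lemma pcong_diff:
  assumes "pcong k x y" "pcong k x' y'"
  shows "pcong k (x - x') (y - y')"
proof -
  obtain z where z: "z \<in> p_integral p" "x = y + of_nat p ^ k * z"
    using assms(1) by (rule pcongE)
  obtain w where w: "w \<in> p_integral p" "x' = y' + of_nat p ^ k * w"
    using assms(2) by (rule pcongE)
  show ?thesis
    using z w by (intro pcongI[of "z - w"]) (auto simp: algebra_simps)
qed

lemma pcong_sum: "(\<And>i. i \<in> A \<Longrightarrow> pcong k (f i) (g i)) \<Longrightarrow> pcong k (sum f A) (sum g A)"
  by (induction A rule: infinite_finite_induct) (auto intro: pcong_add)

end

section \<open>Power sums, Bernoulli numbers and Euler polynomials at $0$\<close>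

lemma fps_exp_geometric_sum:
  "(fps_exp c - 1) * (\<Sum>a<N. fps_exp (of_nat a * c)) = fps_exp (of_nat N * c) - (1 :: 'a :: field_char_0 fps)"
  using power_diff_1_eq[of "fps_exp c" N] by (simp add: fps_exp_power_mult)

text \<open>Division of power series can be undone only when the divisor divides; e^X - 1 has
  subdegree 1 and so divides X.\<close>

lemma bernoulli_egf_mult:
  "Abs_fps (\<lambda>n. bernoulli n / fact n) * (fps_exp 1 - 1) = fps_X"
proof -
  have "subdegree (fps_exp 1 - 1 :: rat fps) = 1"
    by (rule subdegreeI) auto
  then have "(fps_exp 1 - 1 :: rat fps) dvd fps_X"
    by (subst fps_dvd_iff) auto
  then show ?thesis unfolding bernoulli_egf by simp
qed

text \<open>Faulhaber's formula: X times the sum of the e^(aX) equals e^(NX) - 1 times the Bernoulli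
  series, and the coefficients of X^(n+1) are compared.\<close>

lemma sum_powers_bernoulli:
  "(\<Sum>a<N. of_nat a ^ n) =
     (\<Sum>j\<le>n. of_nat (n choose j) * bernoulli (n - j) * of_nat N ^ Suc j / of_nat (Suc j))"
proof -
  define B where "B = Abs_fps (\<lambda>n. bernoulli n / fact n)"
  define F where "F = (\<Sum>a<N. fps_exp (of_nat a :: rat))"
  have "fps_X * F = B * ((fps_exp 1 - 1) * F)"
    using bernoulli_egf_mult by (simp add: B_def flip: mult.assoc)
  also have "\<dots> = B * (fps_exp (of_nat N) - 1)"
    using fps_exp_geometric_sum[of "1 :: rat" N] by (simp add: F_def)
  finally have "fps_nth (fps_X * F) (Suc n) = fps_nth ((fps_exp (of_nat N) - 1) * B) (Suc n)"
    by (simp add: mult.commute)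
  also have "\<dots> = (\<Sum>i=0..Suc n. fps_nth (fps_exp (of_nat N) - 1) i * fps_nth B (Suc n - i))"
    by (rule fps_mult_nth)
  \<comment> \<open>The constant term of e^(NX) - 1 is 0, so the index shifts by one.\<close>
  also have "\<dots> = (\<Sum>j\<le>n. fps_nth (fps_exp (of_nat N) - 1) (Suc j) * fps_nth B (n - j))"
    by (subst sum.atLeast0_atMost_Suc_shift) (simp add: atLeast0AtMost del: fact_Suc power_Suc)
  also have "\<dots> = (\<Sum>j\<le>n. of_nat N ^ Suc j / fact (Suc j) * (bernoulli (n - j) / fact (n - j)))"
    by (simp add: B_def del: fact_Suc power_Suc)
  finally have *: "fps_nth F n = \<dots>" by (simp del: fact_Suc power_Suc)
  have "(\<Sum>a<N. of_nat a ^ n) = fact n * fps_nth F n"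
    by (simp add: F_def fps_sum_nth sum_distrib_left)
  also have "\<dots> = (\<Sum>j\<le>n. of_nat (n choose j) * bernoulli (n - j) * of_nat N ^ Suc j / of_nat (Suc j))"
    unfolding * sum_distrib_left
    by (intro sum.cong refl)
       (simp only: fact_Suc of_nat_mult binomial_fact atMost_iff, simp add: divide_simps)
  finally show ?thesis .
qed

text \<open>The value E_n(0) of the Euler polynomial, written so that B_m/m can be recovered from
  the index n = m - 1.\<close>

definition euler0 :: "nat \<Rightarrow> rat" where
  "euler0 n = 2 * (1 - 2 ^ Suc n) * bernoulli (Suc n) / of_nat (Suc n)"

text \<open>Rests on 1/(e^X + 1) = 1/(e^X - 1) - 2/(e^(2X) - 1). With \<open>C\<close> the Bernoulli
  series at 2X this reads X G = 2 (B - C); multiplying by e^(2X) - 1 clears the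
  denominators.\<close>

lemma euler0_egf: "Abs_fps (\<lambda>n. euler0 n / fact n) * (fps_exp 1 + 1) = 2"
proof -
  define B where "B = Abs_fps (\<lambda>n. bernoulli n / fact n)"
  define C where "C = fps_compose B (fps_const 2 * fps_X)"
  define G where "G = Abs_fps (\<lambda>n. euler0 n / fact n)"
  define E where "E = fps_exp (1 :: rat)"
  have BE: "B * (E - 1) = fps_X"
    using bernoulli_egf_mult by (simp add: B_def E_def)
  have E2: "E * E = fps_exp 2"
    by (simp add: E_def fps_exp_add_mult[symmetric])
  have "C * (E * E - 1) = fps_compose (B * (E - 1)) (fps_const 2 * fps_X)"
    by (simp add: C_def fps_compose_mult_distrib fps_compose_sub_distrib E2)
       (simp add: E_def)
  then have CE: "C * (E * E - 1) = 2 * fps_X"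
    by (simp add: BE numeral_fps_const)
  have C_nth: "fps_nth C n = 2 ^ n * fps_nth B n" for n
    unfolding C_def fps_compose_linear by simp
  have XG: "fps_X * G = 2 * (B - C)"
  proof (rule fps_ext)
    fix n
    show "fps_nth (fps_X * G) n = fps_nth (2 * (B - C)) n"
    proof (cases n)
      case (Suc m)
      have "2 * (1 - 2 ^ n) * bernoulli n / of_nat n / fact m
          = 2 * (bernoulli n / fact n - 2 ^ n * (bernoulli n / fact n))"
        by (simp add: Suc divide_simps) (simp add: algebra_simps)
      then show ?thesis
        by (simp add: Suc G_def B_def C_nth euler0_def numeral_fps_const
              del: fact_Suc power_Suc of_nat_Suc)
    qed (simp add: B_def C_nth)
  qed
  have "(fps_X * (E - 1)) * (G * (E + 1)) = (fps_X * G) * (E * E - 1)"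
    by (simp add: algebra_simps)
  also have "\<dots> = 2 * (B * (E - 1)) * (E + 1) - 2 * (C * (E * E - 1))"
    unfolding XG by (simp add: algebra_simps)
  also have "\<dots> = (fps_X * (E - 1)) * 2"
    unfolding BE CE by (simp add: algebra_simps)
  finally have "(fps_X * (E - 1)) * (G * (E + 1)) = (fps_X * (E - 1)) * 2" .
  moreover have "fps_X * (E - 1) \<noteq> 0"
    using BE by (metis fps_X_neq_zero mult_zero_right mult_eq_0_iff)
  ultimately show ?thesis
    by (simp add: G_def E_def)
qed

text \<open>Geometric series of ratio -e^X: as N is odd, twice the sum has the generating function
  (1 + e^(NX)) G. The summand j = 0 is a second copy of \<open>euler0 n\<close>.\<close>

lemma alternating_sum_powers_euler0:
  assumes "odd N"
  shows "2 * (\<Sum>a<N. (-1) ^ a * of_nat a ^ n) =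
     euler0 n + (\<Sum>j\<le>n. of_nat (n choose j) * euler0 (n - j) * of_nat N ^ j)"
proof -
  define G where "G = Abs_fps (\<lambda>n. euler0 n / fact n)"
  define F where "F = (\<Sum>a<N. (-1) ^ a * fps_exp (of_nat a :: rat))"
  have "(-fps_exp 1 - 1) * (\<Sum>a<N. (-fps_exp (1::rat)) ^ a) = (-fps_exp 1) ^ N - 1"
    using power_diff_1_eq[of "-fps_exp (1::rat)" N] by simp
  moreover have "(-fps_exp 1) ^ a = (-1) ^ a * fps_exp (of_nat a :: rat)" for a
    by (simp add: power_minus[of "fps_exp 1"] fps_exp_power_mult)
  ultimately have "(- fps_exp 1 - 1) * F = - fps_exp (of_nat N) - 1"
    using assms by (simp add: F_def)
  then have "(fps_exp 1 + 1) * F = 1 + fps_exp (of_nat N)"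
    by (metis (no_types, lifting) add.commute minus_add_distrib minus_mult_left minus_minus uminus_add_conv_diff)
  then have "2 * F = G * (1 + fps_exp (of_nat N))"
    using euler0_egf by (simp add: G_def mult.assoc[symmetric] flip: \<open>(fps_exp 1 + 1) * F = _\<close>)
  then have "fps_nth (2 * F) n = fps_nth (G + fps_exp (of_nat N) * G) n"
    by (simp add: algebra_simps)
  then have "2 * fps_nth F n = euler0 n / fact n
      + (\<Sum>j\<le>n. of_nat N ^ j / fact j * (euler0 (n - j) / fact (n - j)))"
    by (simp add: fps_mult_nth[of "fps_exp _"] atLeast0AtMost G_def numeral_fps_const)
  then have "2 * (fact n * fps_nth F n) = euler0 n
      + fact n * (\<Sum>j\<le>n. of_nat N ^ j / fact j * (euler0 (n - j) / fact (n - j)))"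
    by (simp add: field_simps)
  also have "fact n * (\<Sum>j\<le>n. of_nat N ^ j / fact j * (euler0 (n - j) / fact (n - j)))
     = (\<Sum>j\<le>n. of_nat (n choose j) * euler0 (n - j) * of_nat N ^ j)"
    unfolding sum_distrib_left
    by (intro sum.cong refl) (simp add: binomial_fact field_simps)
  also have "fact n * fps_nth F n = (\<Sum>a<N. (-1) ^ a * of_nat a ^ n)"
  proof -
    have "fps_nth ((-1) ^ a * fps_exp (of_nat a :: rat)) n = (-1) ^ a * (of_nat a ^ n / fact n)" for a
      by (cases "even a") auto
    then show ?thesis
      by (simp add: F_def fps_sum_nth sum_distrib_left)
  qed
  finally show ?thesis .
qed

text \<open>2/(e^X + 1) + 2/(e^(-X) + 1) = 2, so the series minus its constant term is odd.\<close>

lemma euler0_even: assumes "even n" "n > 0" shows "euler0 n = 0"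
proof -
  define G where "G = Abs_fps (\<lambda>n. euler0 n / fact n)"
  define H where "H = fps_compose G (- fps_X)"
  define E where "E = fps_exp (1 :: rat)"
  define E' where "E' = fps_exp (-1 :: rat)"
  have EE: "E * E' = 1"
    by (simp add: E_def E'_def fps_exp_add_mult[symmetric])
  have GE: "G * (E + 1) = 2" using euler0_egf by (simp add: G_def E_def)
  have "H * (E' + 1) = fps_compose (G * (E + 1)) (- fps_X)"
    by (simp add: H_def fps_compose_mult_distrib fps_compose_add_distrib)
       (simp add: E_def E'_def)
  then have HE: "H * (E' + 1) = 2"
    by (simp add: GE)
  have "(G + H) * (E + 1) = G * (E + 1) + E * (H * (E' + 1)) - H * (E * E' - 1)"
    by (simp add: algebra_simps)
  also have "\<dots> = 2 * (E + 1)"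
    unfolding GE HE EE by (simp add: algebra_simps)
  finally have "(G + H) * (E + 1) = 2 * (E + 1)" .
  moreover have "E + 1 \<noteq> 0" using GE by auto
  ultimately have "G + H = 2" using mult_right_cancel by blast
  then have "fps_nth G n + fps_nth H n = fps_nth (2 :: rat fps) n" by (metis fps_add_nth)
  moreover have "fps_nth H n = fps_nth G n"
    using assms fps_compose_uminus'[of G] by (simp add: H_def)
  ultimately show ?thesis using assms by (simp add: G_def numeral_fps_const)
qed

text \<open>Read off from \<open>euler0_even\<close>, since the factor 1 - 2^n in
  \<open>euler0 (n - 1)\<close> is nonzero.\<close>

lemma bernoulli_odd: assumes "odd n" "n > 1" shows "bernoulli n = 0"
proof -
  have "euler0 (n - 1) = 0" using assms by (intro euler0_even) auto
  moreover have "Suc (n - 1) = n" using assms by simp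
  moreover have "(1::rat) - 2 ^ n \<noteq> 0" using assms
    by (metis diff_eq_diff_eq diff_self not_less_iff_gr_or_eq one_less_numeral_iff one_less_power semiring_norm(76) zero_less_one less_trans)
  ultimately show ?thesis using assms by (simp add: euler0_def)
qed

text \<open>The case N = 1 of the alternating sum, which then is just 0^n = 0.\<close>

lemma euler0_rec:
  assumes "n > 0"
  shows "2 * euler0 n = - (\<Sum>j=1..n. of_nat (n choose j) * euler0 (n - j))"
proof -
  have "2 * (\<Sum>a<1::nat. (-1) ^ a * of_nat a ^ n) = (0::rat)" using assms by simp
  then have "euler0 n + (\<Sum>j\<le>n. of_nat (n choose j) * euler0 (n - j)) = 0"
    using alternating_sum_powers_euler0[OF odd_one, of n] assms by (simp add: zero_power)
  moreover have "(\<Sum>j\<le>n. of_nat (n choose j) * euler0 (n - j))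
      = euler0 n + (\<Sum>j=1..n. of_nat (n choose j) * euler0 (n - j))"
    by (simp add: atMost_atLeast0 sum.atLeast_Suc_atMost)
  ultimately show ?thesis by simp
qed

section \<open>Stirling numbers and harmonic sums\<close>

lemma stirling_Suc_1: "of_nat (stirling (Suc n) 1) = (fact n :: rat)"
  using stirling_Suc_n_1[of n] by (simp del: stirling.simps)

lemma stirling_Suc_2: "of_nat (stirling (Suc n) 2) = (fact n * (\<Sum>a=1..n. 1 / of_nat a) :: rat)"
proof (induction n)
  case (Suc n)
  have "stirling (Suc (Suc n)) 2 = Suc n * stirling (Suc n) 2 + stirling (Suc n) 1"
    by (simp add: numeral_2_eq_2)
  then have "of_nat (stirling (Suc (Suc n)) 2)
      = of_nat (Suc n) * (fact n * (\<Sum>a=1..n. 1 / of_nat a)) + (fact n :: rat)"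
    by (simp only: of_nat_add of_nat_mult Suc.IH stirling_Suc_1)
  also have "\<dots> = fact (Suc n) * (\<Sum>a=1..Suc n. 1 / of_nat a)"
    by (simp add: field_simps)
  finally show ?case .
qed (simp add: numeral_2_eq_2)

text \<open>The second factor, halved, is the elementary symmetric polynomial e_2 of 1, 1/2, ...,
  1/n in Newton's form; the induction follows the Stirling recurrence.\<close>

lemma stirling_Suc_3:
  "of_nat (stirling (Suc n) 3) =
     (fact n / 2 * ((\<Sum>a=1..n. 1 / of_nat a)\<^sup>2 - (\<Sum>a=1..n. 1 / (of_nat a)\<^sup>2)) :: rat)"
proof (induction n)
  case (Suc n)
  let ?H = "\<Sum>a=1..n. 1 / (of_nat a :: rat)" and ?K = "\<Sum>a=1..n. 1 / (of_nat a :: rat)\<^sup>2"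
  let ?N = "of_nat (Suc n) :: rat"
  have "stirling (Suc (Suc n)) 3 = Suc n * stirling (Suc n) 3 + stirling (Suc n) 2"
    by (simp add: numeral_2_eq_2 numeral_3_eq_3)
  then have "of_nat (stirling (Suc (Suc n)) 3) = ?N * (fact n / 2 * (?H\<^sup>2 - ?K)) + fact n * ?H"
    by (simp only: of_nat_add of_nat_mult Suc.IH stirling_Suc_2)
  also have "\<dots> = ?N * fact n / 2 * ((?H + 1 / ?N)\<^sup>2 - (?K + 1 / ?N\<^sup>2))"
    by (simp add: power2_eq_square divide_simps del: of_nat_Suc) (simp add: algebra_simps)
  also have "\<dots> = fact (Suc n) / 2 * ((\<Sum>a=1..Suc n. 1 / of_nat a)\<^sup>2 - (\<Sum>a=1..Suc n. 1 / (of_nat a)\<^sup>2))"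
    by simp
  finally show ?case .
qed (simp add: numeral_3_eq_3)

section \<open>Congruences modulo powers of $p$\<close>

text \<open>Controls the denominators j + 1 in Faulhaber's formula once p^k with k at most 3 has
  been split off.\<close>

lemma add_3_less_power:
  assumes "i \<ge> 1" "(p::nat) \<ge> 5"
  shows "i + 3 < p ^ i"
  using assms(1)
proof (induction i rule: dec_induct)
  case (step i)
  have "i + 3 < p ^ i" by fact
  moreover have "5 * p ^ i \<le> p ^ Suc i" using assms(2) by simp
  ultimately show ?case by linarith
qed (use assms in simp)

context
  fixes p :: nat
  assumes p: "prime p"
begin

text \<open>A positive number below p^(k+1) is divisible by p at most k times.\<close>

lemma power_div_p_integral:
  assumes "0 < m" "m < p ^ Suc k"
  shows "of_nat p ^ k / of_nat m \<in> p_integral p"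
proof -
  obtain r where r: "m = p ^ multiplicity p m * r" "\<not> p dvd r"
    using multiplicity_decompose'[of m p] assms p not_prime_unit by blast
  let ?v = "multiplicity p m"
  have "r > 0" using r assms(1) by (cases r) auto
  then have "p ^ ?v \<le> m" using r(1) by (metis Suc_leI mult.right_neutral mult_le_mono2 One_nat_def)
  with assms(2) have "p ^ ?v < p ^ Suc k" by linarith
  then have v: "?v \<le> k"
    using prime_gt_1_nat[OF p] power_less_imp_less_exp by (metis less_Suc_eq_le)
  have "of_nat p ^ k / of_nat m = (of_nat p ^ ?v * of_nat p ^ (k - ?v)) / (of_nat p ^ ?v * of_nat r :: rat)"
    using v by (subst r(1)) (simp flip: power_add)
  also have "\<dots> = of_nat p ^ (k - ?v) / of_nat r"
    using prime_gt_0_nat[OF p] by simp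
  also have "\<dots> \<in> p_integral p"
    using r(2) p by (intro p_integral_divide_nat) auto
  finally show ?thesis .
qed

text \<open>One factor p is attached to each Bernoulli number, because in general only p B_i is
  p-integral.\<close>

lemma sum_powers_bernoulli_prime:
  "(\<Sum>a<p. of_nat a ^ n) = of_nat p * bernoulli n +
     (\<Sum>j=1..n. of_nat (n choose j) * (of_nat p * bernoulli (n - j)) * (of_nat p ^ j / of_nat (Suc j)))"
  unfolding sum_powers_bernoulli
  by (simp add: atMost_atLeast0 sum.atLeast_Suc_atMost)
     (intro sum.cong refl, simp add: mult_ac)

text \<open>A weak form of von Staudt-Clausen: strong induction, solving the power sum formula for p
  B_n.\<close>

lemma p_bernoulli_p_integral: "of_nat p * bernoulli n \<in> p_integral p"
proof (induction n rule: less_induct)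
  case (less n)
  have "of_nat (n choose j) * (of_nat p * bernoulli (n - j)) * (of_nat p ^ j / of_nat (Suc j)) \<in> p_integral p"
    if "j \<in> {1..n}" for j
  proof (rule p_integral_mult[OF p])
    show "of_nat (n choose j) * (of_nat p * bernoulli (n - j)) \<in> p_integral p"
      using that by (intro p_integral_mult[OF p p_integral_of_nat[OF p] less.IH]) auto
    show "of_nat p ^ j / of_nat (Suc j) \<in> p_integral p"
    proof (rule power_div_p_integral)
      have "Suc j < 2 ^ Suc j" by (rule less_exp)
      also have "\<dots> \<le> p ^ Suc j" using prime_ge_2_nat[OF p] by (rule power_mono) simp
      finally show "Suc j < p ^ Suc j" .
    qed simp
  qed
  then have "(\<Sum>a<p. of_nat a ^ n) - (\<Sum>j=1..n. of_nat (n choose j) *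
      (of_nat p * bernoulli (n - j)) * (of_nat p ^ j / of_nat (Suc j))) \<in> p_integral p"
    using p by (intro p_integral_diff p_integral_sum p_integral_power) auto
  then show ?case by (simp add: sum_powers_bernoulli_prime)
qed

text \<open>The term j = 1 vanishes because n - 1 is odd and exceeds 1, and the terms with j >= k
  are divisible by p^k. For k = 3 there remains j = 2, where the p in p B_(n-2) counts in full once
  B_(n-2) itself is p-integral.\<close>

lemma sum_powers_pcong:
  assumes "p \<ge> 5" "even n" "n \<ge> 4"
    and "k = 2 \<or> k = 3 \<and> bernoulli (n - 2) \<in> p_integral p"
  shows "pcong p k (\<Sum>a<p. of_nat a ^ n) (of_nat p * bernoulli n)"
proof -
  have "pcong p k (of_nat (n choose j) * (of_nat p * bernoulli (n - j)) * (of_nat p ^ j / of_nat (Suc j))) 0"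
    (is "pcong p k (?C * ?B * ?D) 0") if j: "j \<in> {1..n}" for j
  proof -
    consider "j = 1" | "j = 2" "k = 3" | "j \<ge> k" using assms(4) j by fastforce
    then show ?thesis
    proof cases
      case 1
      then have "bernoulli (n - j) = 0" using assms by (intro bernoulli_odd) auto
      then show ?thesis using p by simp
    next
      case 2
      then have "bernoulli (n - 2) / of_nat 3 \<in> p_integral p"
        using assms p by (intro p_integral_divide_nat) (auto dest: dvd_imp_le)
      then show ?thesis
        using 2 p_integral_mult[OF p p_integral_of_nat[OF p], of "bernoulli (n - 2) / of_nat 3" "n choose j"]
        by (intro pcongI[OF p, where z = "?C * (bernoulli (n - 2) / of_nat 3)"])
          (simp_all add: power3_eq_cube power2_eq_square)
    next
      case 3
      \<comment> \<open>Here p^j = p^k p^(i-1) and j + 1 = k + i <= i + 3 < p^i, so p^(i-1) absorbs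
        the denominator.\<close>
      define i where "i = j + 1 - k"
      have i: "i \<ge> 1" "j = k + (i - 1)" using 3 by (auto simp: i_def)
      have "Suc j \<le> i + 3" using i assms(4) by auto
      also have "\<dots> < p ^ i" using i(1) assms(1) by (rule add_3_less_power)
      also have "\<dots> = p ^ Suc (i - 1)" using i(1) by simp
      finally have "of_nat p ^ (i - 1) / of_nat (Suc j) \<in> p_integral p"
        by (intro power_div_p_integral) auto
      with p_integral_mult[OF p p_integral_of_nat[OF p] p_bernoulli_p_integral]
      have "?C * ?B * (of_nat p ^ (i - 1) / of_nat (Suc j)) \<in> p_integral p"
        by (rule p_integral_mult[OF p])
      moreover have "(of_nat p :: rat) ^ j = of_nat p ^ k * of_nat p ^ (i - 1)"
        unfolding i(2) by (rule power_add)
      ultimately show ?thesis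
        by (intro pcongI[OF p]) (auto simp del: of_nat_Suc)
    qed
  qed
  then have "pcong p k (\<Sum>j=1..n. of_nat (n choose j) * (of_nat p * bernoulli (n - j)) *
      (of_nat p ^ j / of_nat (Suc j))) (\<Sum>j=1..n. 0)"
    using p by (intro pcong_sum) auto
  from pcong_add[OF p pcong_refl[OF p, of k "of_nat p * bernoulli n"] this] show ?thesis
    by (simp add: sum_powers_bernoulli_prime)
qed

text \<open>\<open>euler0_rec\<close> divides only by 2, a unit for odd p.\<close>

lemma euler0_p_integral:
  assumes "odd p"
  shows "euler0 n \<in> p_integral p"
proof (induction n rule: less_induct)
  case (less n)
  have half: "x / 2 \<in> p_integral p" if "x \<in> p_integral p" for x
    using that assms p_integral_divide_nat[OF p, of x 2] primes_dvd_imp_eq[OF p two_is_prime_nat]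
    by auto
  show ?case
  proof (cases "n = 0")
    case True
    have "euler0 0 = 1" by (simp add: euler0_def bernoulli.simps)
    then show ?thesis using True p by simp
  next
    case False
    then have "2 * euler0 n \<in> p_integral p"
      using euler0_rec[of n] less p
      by (auto intro!: p_integral_uminus p_integral_sum p_integral_mult)
    from half[OF this] show ?thesis by simp
  qed
qed

text \<open>B_n/n equals -E_(n-1)(0) / (2 (2^n - 1)), with both factors of the denominator prime to
  p.\<close>

lemma bernoulli_div_p_integral:
  assumes "odd p" "n > 0" "\<not> int p dvd 2 ^ n - 1"
  shows "bernoulli n / of_nat n \<in> p_integral p"
proof -
  have p2: "\<not> p dvd 2"
    using assms(1) primes_dvd_imp_eq[OF p two_is_prime_nat] by auto
  have "euler0 (n - 1) / of_nat 2 / of_int (2 ^ n - 1) \<in> p_integral p"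
    using p p2 assms(3) euler0_p_integral[OF assms(1)]
    by (intro p_integral_divide_int p_integral_divide_nat) auto
  moreover have "(2::rat) ^ n \<noteq> 1"
    using assms(3) by (metis diff_self dvd_0_right of_int_1 of_int_eq_iff of_int_numeral of_int_power)
  then have "euler0 (n - 1) / of_nat 2 / of_int (2 ^ n - 1) = - (bernoulli n / of_nat n)"
    using assms(2) by (simp add: euler0_def divide_simps) (simp add: algebra_simps)
  ultimately show ?thesis using p_integral_uminus[OF p, of "- (bernoulli n / of_nat n)"] by simp
qed

lemma bernoulli_p_integral:
  assumes "odd p" "n > 0" "\<not> int p dvd 2 ^ n - 1"
  shows "bernoulli n \<in> p_integral p"
  using p_integral_mult[OF p p_integral_of_nat[OF p, of n] bernoulli_div_p_integral[OF assms]]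
    assms(2) by simp

text \<open>In the exact formula the terms j >= 2 carry p^2, the term j = 1 vanishes because n - 1
  is even and positive, and j = 0 doubles \<open>euler0 n\<close>.\<close>

lemma alternating_sum_powers_pcong:
  assumes "odd p" "odd n" "n > 1"
  shows "pcong p 2 (\<Sum>a<p. (-1) ^ a * of_nat a ^ n) (euler0 n)"
proof -
  have j_term: "pcong p 2 (of_nat (n choose j) * euler0 (n - j) * of_nat p ^ j) 0" if "j \<in> {1..n}" for j
  proof (cases "j = 1")
    case True
    have "euler0 (n - 1) = 0" using assms by (intro euler0_even) auto
    then show ?thesis using True p by simp
  next
    case False
    then have "j = 2 + (j - 2)" using that by auto
    then have "(of_nat p :: rat) ^ j = of_nat p ^ 2 * of_nat p ^ (j - 2)" by (metis power_add)
    then show ?thesis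
      using p euler0_p_integral[OF assms(1)]
      by (intro pcongI[where z = "of_nat (n choose j) * euler0 (n - j) * of_nat p ^ (j - 2)"]) auto
  qed
  have "pcong p 2 (\<Sum>j=1..n. of_nat (n choose j) * euler0 (n - j) * of_nat p ^ j) (\<Sum>j=1..n. 0)"
    using p j_term by (intro pcong_sum) auto
  then obtain z where z: "z \<in> p_integral p"
    "(\<Sum>j=1..n. of_nat (n choose j) * euler0 (n - j) * of_nat p ^ j) = of_nat p ^ 2 * z"
    using p by (auto elim!: pcongE)
  have "z / of_nat 2 \<in> p_integral p"
    using z(1) p assms(1) primes_dvd_imp_eq[OF p two_is_prime_nat]
    by (intro p_integral_divide_nat) auto
  moreover have "2 * (\<Sum>a<p. (-1) ^ a * of_nat a ^ n) = 2 * euler0 n + of_nat p ^ 2 * z"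
    using alternating_sum_powers_euler0[OF assms(1), of n] z(2)
    by (simp add: atMost_atLeast0 sum.atLeast_Suc_atMost)
  ultimately show ?thesis
    using p by (intro pcongI[where z = "z / of_nat 2"]) (auto simp: field_simps)
qed

section \<open>Fermat quotients and (p-1)! modulo p^2\<close>

lemma fermat_quotient_p_integral:
  assumes "\<not> p dvd a"
  shows "fermat_quotient p a \<in> p_integral p"
proof -
  have "[a ^ (p - 1) = 1] (mod p)" using assms p by (intro fermat_theorem)
  then have "int p dvd int a ^ (p - 1) - 1"
    by (metis cong_iff_dvd_diff cong_int_iff of_nat_1 of_nat_power)
  then obtain k where "int a ^ (p - 1) - 1 = int p * k" by blast
  then have "of_int (int a ^ (p - 1) - 1) = (of_int (int p * k) :: rat)" by simp
  then have "fermat_quotient p a = of_int k"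
    using prime_gt_0_nat[OF p] by (simp add: fermat_quotient_def)
  then show ?thesis using p by simp
qed

lemma power_fermat_quotient: "of_nat a ^ (p - 1) = 1 + of_nat p * fermat_quotient p a"
  using prime_gt_0_nat[OF p] by (simp add: fermat_quotient_def)

lemma prod_1_plus_pcong:
  assumes "finite A" "\<And>a. a \<in> A \<Longrightarrow> f a \<in> p_integral p"
  shows "pcong p 2 (\<Prod>a\<in>A. 1 + of_nat p * f a) (1 + of_nat p * (\<Sum>a\<in>A. f a))"
  using assms
proof (induction A rule: finite_induct)
  case (insert x A)
  then obtain z where z: "z \<in> p_integral p"
    "(\<Prod>a\<in>A. 1 + of_nat p * f a) = 1 + of_nat p * (\<Sum>a\<in>A. f a) + of_nat p ^ 2 * z"
    using p by (auto elim!: pcongE)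
  have "(\<Sum>a\<in>A. f a) \<in> p_integral p" using insert p by (intro p_integral_sum) auto
  then show ?case
    using insert z p
    by (intro pcongI[where z = "f x * (\<Sum>a\<in>A. f a) + z * (1 + of_nat p * f x)"])
       (auto simp: algebra_simps power2_eq_square)
qed (use p in simp)

text \<open>Lerch's congruence. Wilson gives (p-1)! = -1 + p k; its power of exponent p - 1 is both
  (1 - p k)^(p-1) and the product of the a^(p-1) = 1 + p q_a. First-order expansion of both shows
  that k is the sum of the q_a modulo p.\<close>

lemma fact_pcong_sum_fermat_quotient:
  assumes "odd p"
  shows "pcong p 2 (fact (p - 1)) (- 1 + of_nat p * (\<Sum>a=1..p-1. fermat_quotient p a))"
proof -
  let ?q = "fermat_quotient p" and ?P = "of_nat p :: rat"
  have q: "?q a \<in> p_integral p" if "a \<in> {1..p-1}" for a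
    using that by (intro fermat_quotient_p_integral) (auto dest: dvd_imp_le)
  have "[fact (p - 1) = - 1] (mod int p)" using wilson_theorem[OF p] by simp
  then obtain k where k: "fact (p - 1) = - 1 + int p * k"
    by (metis cong_iff_lin cong_sym)
  have "(of_int (fact (p - 1)) :: rat) = of_int (- 1 + int p * k)" by (simp only: k)
  then have W: "fact (p - 1) = - 1 + ?P * of_int k" by simp
  have "1 + ?P * (- of_int k) = - fact (p - 1)" unfolding W by simp
  \<comment> \<open>The power is written as a constant product, so that
    \<open>prod_1_plus_pcong\<close> expands both sides.\<close>
  then have "(\<Prod>a=1..p-1. 1 + ?P * (- of_int k)) = (- fact (p - 1)) ^ (p - 1)"
    by simp
  also have "\<dots> = fact (p - 1) ^ (p - 1)" using assms by (intro power_minus_even) simp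
  also have "\<dots> = (\<Prod>a=1..p-1. 1 + ?P * ?q a)"
    by (simp add: fact_prod prod_power_distrib flip: power_fermat_quotient)
  finally have eq: "(\<Prod>a=1..p-1. 1 + ?P * (- of_int k)) = (\<Prod>a=1..p-1. 1 + ?P * ?q a)" .
  have "pcong p 2 (\<Prod>a=1..p-1. 1 + ?P * ?q a) (1 + ?P * (\<Sum>a=1..p-1. ?q a))"
    using q by (intro prod_1_plus_pcong) auto
  moreover have "pcong p 2 (\<Prod>a=1..p-1. 1 + ?P * ?q a) (1 + ?P * (\<Sum>a=1..p-1. - of_int k))"
    unfolding eq[symmetric] using p by (intro prod_1_plus_pcong) auto
  ultimately have "pcong p 2 (1 + ?P * (\<Sum>a=1..p-1. - of_int k)) (1 + ?P * (\<Sum>a=1..p-1. ?q a))"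
    using pcong_sym[OF p] pcong_trans[OF p] by blast
  moreover have "(of_nat (p - 1) :: rat) = ?P - 1" using prime_gt_0_nat[OF p] by (simp add: of_nat_diff)
  ultimately obtain z where z: "z \<in> p_integral p"
    "1 - ?P * (?P - 1) * of_int k = 1 + ?P * (\<Sum>a=1..p-1. ?q a) + ?P ^ 2 * z"
    using p by (auto elim!: pcongE simp: mult.assoc)
  moreover have "?P * (?P - 1) * of_int k = ?P ^ 2 * of_int k - ?P * of_int k"
    by (simp add: algebra_simps power2_eq_square)
  ultimately have "fact (p - 1) - (- 1 + ?P * (\<Sum>a=1..p-1. ?q a)) = ?P ^ 2 * (of_int k + z)"
    unfolding W by (simp only: distrib_left)
  then show ?thesis
    using z(1) p by (intro pcongI[where z = "of_int k + z"]) auto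
qed

text \<open>The sum of the q_a is eliminated from Lerch's congruence: the sum of the a^(p-1) is p -
  1 plus p times it, and also p B_(p-1) modulo p^2.\<close>

lemma fact_pcong_bernoulli:
  assumes "p \<ge> 5"
  shows "pcong p 2 (fact (p - 1)) (of_nat p * bernoulli (p - 1) - of_nat p)"
proof -
  let ?q = "fermat_quotient p" and ?P = "of_nat p :: rat"
  have "odd p" using assms p primes_dvd_imp_eq[OF two_is_prime_nat p] by auto
  have "(\<Sum>a<p. of_nat a ^ (p - 1)) = (\<Sum>a=1..p-1. (of_nat a :: rat) ^ (p - 1))"
    using assms by (intro sum.mono_neutral_right) (auto simp: not_less_eq_eq)
  also have "\<dots> = ?P - 1 + ?P * (\<Sum>a=1..p-1. ?q a)"
    unfolding power_fermat_quotient sum.distrib sum_distrib_left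
    using assms by (simp add: of_nat_diff)
  finally have "pcong p 2 (?P - 1 + ?P * (\<Sum>a=1..p-1. ?q a)) (?P * bernoulli (p - 1))"
    using sum_powers_pcong[of "p - 1" 2] assms \<open>odd p\<close> by simp
  from pcong_diff[OF p this pcong_refl[OF p, of 2 "?P"]]
  have "pcong p 2 (- 1 + ?P * (\<Sum>a=1..p-1. ?q a)) (?P * bernoulli (p - 1) - ?P)"
    by (simp add: algebra_simps)
  with fact_pcong_sum_fermat_quotient[OF \<open>odd p\<close>] show ?thesis by (rule pcong_trans[OF p])
qed

end

section \<open>Second-order Kummer congruences\<close>

context
  fixes p :: nat
  assumes p: "prime p"
begin

lemma dvd_two_power_minus_1_periodic:
  assumes "odd p"
  shows "int p dvd 2 ^ (n + k * (p - 1)) - 1 \<longleftrightarrow> int p dvd 2 ^ n - 1"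
proof -
  have "\<not> p dvd 2" using assms primes_dvd_imp_eq[OF p two_is_prime_nat] by auto
  then have "[2 ^ (p - 1) = 1] (mod p)" by (rule fermat_theorem[OF p])
  then have "[(2 ^ (p - 1)) ^ k = 1 ^ k] (mod p)" by (rule cong_pow)
  then have "[2 ^ n * 2 ^ (k * (p - 1)) = 2 ^ n * 1] (mod p)"
    by (intro cong_scalar_left) (simp add: power_mult mult.commute[of k])
  then have "[2 ^ (n + k * (p - 1)) = 2 ^ n] (mod int p)"
    by (metis cong_int_iff mult.right_neutral of_nat_numeral of_nat_power power_add)
  then have "[2 ^ (n + k * (p - 1)) - 1 = 2 ^ n - 1] (mod int p)"
    by (intro cong_diff cong_refl)
  then show ?thesis by (rule cong_dvd_iff)
qed

text \<open>By Fermat, 2^m is inverse to 2^r modulo p. A condition at a large exponent m is thus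
  reduced to a small explicit r.\<close>

lemma two_power_minus_1_not_dvd:
  assumes "odd p" "m + r = k * (p - 1)" "\<not> int p dvd 2 ^ r - 1"
  shows "\<not> int p dvd 2 ^ m - 1"
proof
  assume "int p dvd 2 ^ m - 1"
  moreover have "int p dvd 2 ^ (m + r) - 1"
    using dvd_two_power_minus_1_periodic[OF assms(1), of 0 k] by (simp add: assms(2))
  moreover have "(2::int) ^ (m + r) - 1 = 2 ^ r * (2 ^ m - 1) + (2 ^ r - 1)"
    by (simp add: power_add algebra_simps)
  ultimately have "int p dvd 2 ^ r - 1" by (metis dvd_add_right_iff dvd_mult)
  with assms(3) show False by contradiction
qed

lemma sum_weighted_powers_lessThan:
  assumes "n > 0"
  shows "(\<Sum>a<p. w a * of_nat a ^ n) = (\<Sum>a=1..p-1. w a * (of_nat a :: rat) ^ n)"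
  using assms prime_gt_0_nat[OF p]
  by (intro sum.mono_neutral_right) (auto simp: not_less_eq_eq)

lemma power_add_fermat_quotient:
  "of_nat a ^ (n + (p - 1)) = of_nat a ^ n * (1 + of_nat p * fermat_quotient p a)"
  "of_nat a ^ (n + 2 * (p - 1)) = of_nat a ^ n * (1 + of_nat p * fermat_quotient p a)\<^sup>2"
  unfolding power_fermat_quotient[OF p, symmetric]
  by (simp_all add: power_add mult.commute flip: power_mult)

text \<open>Meant for x_j = B_m/m with m = n + j (p-1), c = 2^n and t = q_2, so that c (1 + P t)^j =
  2^m. The factors 1 - 2^m differ from the unit 1 - c by multiples of P, and are stripped off first
  modulo P, then modulo P^2.\<close>

lemma second_difference_cancel:
  fixes x0 x1 x2 c t w z :: rat
  defines "P \<equiv> of_nat p"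
  assumes int: "x0 \<in> p_integral p" "x1 \<in> p_integral p" "x2 \<in> p_integral p"
    "c \<in> p_integral p" "t \<in> p_integral p" "z \<in> p_integral p" "w \<in> p_integral p"
    and unit: "c \<noteq> 1" "1 / (1 - c) \<in> p_integral p"
    and first: "(1 - c * (1 + P * t)) * x1 - (1 - c) * x0 = P * z"
    and second: "(1 - c * (1 + P * t)\<^sup>2) * x2 - 2 * ((1 - c * (1 + P * t)) * x1) + (1 - c) * x0 = P\<^sup>2 * w"
  obtains d e where "d \<in> p_integral p" "e \<in> p_integral p"
    "x1 = x0 + P * d" "x2 = x0 + 2 * P * d + P\<^sup>2 * e"
proof -
  define u where "u = 1 / (1 - c)"
  have u: "u \<in> p_integral p" "u * (1 - c) = 1" using unit by (auto simp: u_def)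
  define d where "d = u * (z + c * t * x1)"
  \<comment> \<open>The second difference divided by P alone. It yields x2 - x1 = P (f + d), which
    makes the terms 2 c t (x2 - x1) in \<open>f\<close> divisible by P and leads to
    \<open>e\<close>.\<close>
  define f where "f = u * (P * w - 2 * c * t * x1 + 2 * c * t * x2 + c * P * t\<^sup>2 * x2)"
  define e where "e = u * (w + 2 * c * t * (f + d) + c * t\<^sup>2 * x2)"
  have P: "P \<in> p_integral p" using p by (simp add: P_def)
  have d: "d \<in> p_integral p" using u int p unfolding d_def by auto
  have f: "f \<in> p_integral p" using u int p P unfolding f_def by auto
  have e: "e \<in> p_integral p" using u int d f p unfolding e_def by auto
  have "x1 - x0 = u * ((1 - c) * (x1 - x0))" using u(2) by (simp flip: mult.assoc)
  also have "(1 - c) * (x1 - x0) = P * (z + c * t * x1)"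
    using first by (simp add: algebra_simps)
  finally have x1: "x1 - x0 = P * d" by (simp add: d_def mult_ac)
  have scaled: "x2 - 2 * x1 + x0 = u * ((1 - c) * (x2 - 2 * x1 + x0))"
    using u(2) by (simp flip: mult.assoc)
  have "(1 - c) * (x2 - 2 * x1 + x0)
      = P\<^sup>2 * w - 2 * c * P * t * x1 + c * (2 * P * t + P\<^sup>2 * t\<^sup>2) * x2"
    using second by (simp add: algebra_simps power2_eq_square)
  also have "\<dots> = P * (P * w - 2 * c * t * x1 + 2 * c * t * x2 + c * P * t\<^sup>2 * x2)"
    by (simp add: algebra_simps power2_eq_square)
  finally have expand: "(1 - c) * (x2 - 2 * x1 + x0)
      = P * (P * w - 2 * c * t * x1 + 2 * c * t * x2 + c * P * t\<^sup>2 * x2)" .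
  have "x2 - 2 * x1 + x0 = P * f"
    using scaled unfolding expand f_def by (simp only: mult.left_commute)
  with x1 have "x2 - x1 = P * (f + d)" by (simp add: algebra_simps)
  then have "x2 = x1 + P * (f + d)" by simp
  then have "P * (P * w - 2 * c * t * x1 + 2 * c * t * x2 + c * P * t\<^sup>2 * x2)
      = P\<^sup>2 * (w + 2 * c * t * (f + d) + c * t\<^sup>2 * x2)"
    by (simp add: algebra_simps power2_eq_square)
  then have "x2 - 2 * x1 + x0 = P\<^sup>2 * e"
    using scaled unfolding expand e_def by (simp only: mult.left_commute)
  with x1 have "x2 = x0 + 2 * P * d + P\<^sup>2 * e" by (simp add: algebra_simps)
  with x1 d e show ?thesis by (intro that[of d e]) auto
qed

text \<open>The alternating sums with exponents n - 1 + j (p-1) have summands a^(n-1) (1 + p q_a)^j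
  up to sign, so their first and second differences carry p and p^2. They agree modulo p^2 with 2 (1
  - 2^m) B_m/m, and \<open>second_difference_cancel\<close> removes the factor 1 - 2^m.\<close>

lemma kummer_second_order:
  assumes "odd p" "even n" "n > 2" "\<not> int p dvd 2 ^ n - 1"
  obtains d e where "d \<in> p_integral p" "e \<in> p_integral p"
    "bernoulli (n + (p - 1)) / of_nat (n + (p - 1)) = bernoulli n / of_nat n + of_nat p * d"
    "bernoulli (n + 2 * (p - 1)) / of_nat (n + 2 * (p - 1))
       = bernoulli n / of_nat n + 2 * of_nat p * d + (of_nat p)\<^sup>2 * e"
proof -
  define P :: rat where "P = of_nat p"
  define q where "q = fermat_quotient p"
  define b where "b m = bernoulli m / of_nat m" for m
  define c :: rat where "c = 2 ^ n"
  define T where "T m = (\<Sum>a<p. (-1) ^ a * (of_nat a :: rat) ^ (m - 1))" for m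
  have p2: "\<not> p dvd 2" using assms(1) primes_dvd_imp_eq[OF p two_is_prime_nat] by auto
  have half: "x / 2 \<in> p_integral p" if "x \<in> p_integral p" for x
    using p_integral_divide_nat[OF p that p2] by simp
  have q: "q a \<in> p_integral p" if "a \<in> {1..p-1}" for a
    using that unfolding q_def by (intro fermat_quotient_p_integral[OF p]) (auto dest: dvd_imp_le)
  have "even (p - 1)" using assms(1) by simp
  have b_int: "b (n + k * (p - 1)) \<in> p_integral p" for k
    unfolding b_def using assms dvd_two_power_minus_1_periodic by (intro bernoulli_div_p_integral[OF p]) auto
  have T: "pcong p 2 (T m) (2 * ((1 - 2 ^ m) * b m))" if "even m" "m > 2" for m
  proof -
    have "euler0 (m - 1) = 2 * ((1 - 2 ^ m) * b m)"
      using that by (simp add: euler0_def b_def)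
    then show ?thesis
      using alternating_sum_powers_pcong[OF p assms(1), of "m - 1"] that
      unfolding T_def by simp
  qed
  have T_sum: "T m = (\<Sum>a=1..p-1. (-1) ^ a * of_nat a ^ (m - 1))" if "m > 2" for m
    unfolding T_def using that by (intro sum_weighted_powers_lessThan) auto
  have T0: "T n = (\<Sum>a=1..p-1. (-1) ^ a * of_nat a ^ (n - 1))"
    using T_sum assms(3) by simp
  have T1: "T (n + (p - 1)) = (\<Sum>a=1..p-1. (-1) ^ a * (of_nat a ^ (n - 1) * (1 + P * q a)))"
    using assms(3) unfolding P_def q_def power_add_fermat_quotient[symmetric]
    by (subst T_sum) auto
  have T2: "T (n + 2 * (p - 1)) = (\<Sum>a=1..p-1. (-1) ^ a * (of_nat a ^ (n - 1) * (1 + P * q a)\<^sup>2))"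
    using assms(3) unfolding P_def q_def power_add_fermat_quotient[symmetric]
    by (subst T_sum) auto
  define z1 where "z1 = (\<Sum>a=1..p-1. (-1) ^ a * (of_nat a ^ (n - 1) * q a))"
  define z2 where "z2 = (\<Sum>a=1..p-1. (-1) ^ a * (of_nat a ^ (n - 1) * (q a)\<^sup>2))"
  have sgn_int: "(-1) ^ a \<in> p_integral p" for a :: nat
    using p by (intro p_integral_power p_integral_uminus) auto
  have z1: "z1 \<in> p_integral p" and z2: "z2 \<in> p_integral p"
    unfolding z1_def z2_def using p q sgn_int
    by (auto intro!: p_integral_sum p_integral_mult p_integral_power)
  have "T (n + (p - 1)) - T n = P * z1"
    unfolding T0 T1 z1_def sum_distrib_left sum_subtractf[symmetric]
    by (intro sum.cong refl) (simp add: algebra_simps)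
  moreover have "T (n + 2 * (p - 1)) - 2 * T (n + (p - 1)) + T n = P\<^sup>2 * z2"
    unfolding T0 T1 T2 z2_def sum_distrib_left sum_subtractf[symmetric] sum.distrib[symmetric]
    by (intro sum.cong refl) (simp add: algebra_simps power2_eq_square)
  moreover obtain y0 where y0: "y0 \<in> p_integral p" "T n = 2 * ((1 - c) * b n) + P\<^sup>2 * y0"
    using T[of n] assms p by (auto elim!: pcongE simp: P_def c_def)
  moreover obtain y1 where y1: "y1 \<in> p_integral p"
    "T (n + (p - 1)) = 2 * ((1 - 2 ^ (n + (p - 1))) * b (n + (p - 1))) + P\<^sup>2 * y1"
    using T[of "n + (p - 1)"] assms p by (auto elim!: pcongE simp: P_def)
  moreover obtain y2 where y2: "y2 \<in> p_integral p"
    "T (n + 2 * (p - 1)) = 2 * ((1 - 2 ^ (n + 2 * (p - 1))) * b (n + 2 * (p - 1))) + P\<^sup>2 * y2"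
    using T[of "n + 2 * (p - 1)"] assms p by (auto elim!: pcongE simp: P_def)
  \<comment> \<open>The halves undo the factor 2 in \<open>euler0\<close>; the \<open>y0\<close>,
    \<open>y1\<close>, \<open>y2\<close> are the errors modulo P^2.\<close>
  ultimately have
    e1: "(1 - 2 ^ (n + (p - 1))) * b (n + (p - 1)) - (1 - c) * b n = P * ((z1 + P * y0 - P * y1) / 2)"
    and e2: "(1 - 2 ^ (n + 2 * (p - 1))) * b (n + 2 * (p - 1))
      - 2 * ((1 - 2 ^ (n + (p - 1))) * b (n + (p - 1))) + (1 - c) * b n
      = P\<^sup>2 * ((z2 - y0 + 2 * y1 - y2) / 2)"
    by (simp_all add: algebra_simps power2_eq_square)
  have c1: "2 ^ (n + (p - 1)) = c * (1 + P * q 2)" and c2: "2 ^ (n + 2 * (p - 1)) = c * (1 + P * q 2)\<^sup>2"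
    using power_add_fermat_quotient[of 2 n] by (simp_all add: c_def P_def q_def)
  have "\<not> int p dvd 1 - 2 ^ n" using assms(4) by (metis dvd_minus_iff minus_diff_eq)
  then have "1 / of_int (1 - 2 ^ n) \<in> p_integral p"
    using p by (intro p_integral_divide_int) auto
  then have unit: "1 / (1 - c) \<in> p_integral p" by (simp add: c_def)
  have "c \<noteq> 1"
    using assms(4) unfolding c_def
    by (metis diff_self dvd_0_right of_int_1 of_int_eq_iff of_int_numeral of_int_power)
  have ints: "(z1 + P * y0 - P * y1) / 2 \<in> p_integral p" "(z2 - y0 + 2 * y1 - y2) / 2 \<in> p_integral p"
    using half z1 z2 y0(1) y1(1) y2(1) p by (auto simp: P_def)
  have "c \<in> p_integral p" using p by (auto simp: c_def)
  moreover have "q 2 \<in> p_integral p" using fermat_quotient_p_integral[OF p p2] by (simp add: q_def)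
  ultimately show ?thesis
    using second_difference_cancel[OF b_int[of 0] b_int[of 1] b_int[of 2] _ _ ints \<open>c \<noteq> 1\<close> unit
        , of "q 2", folded P_def] e1 e2 that
    unfolding c1 c2 by (simp add: b_def P_def) blast
qed

end

section \<open>The third Stirling number\<close>

text \<open>Pairing a with p - a gives 1/a + 1/(p-a) = p/(a (p-a)), where 1/(a (p-a)) = p/(a^2
  (p-a)) - 1/a^2. So twice the harmonic sum is p^2 R minus p times the sum of the 1/a^2, itself a
  multiple of p.\<close>

lemma wolstenholme_harmonic:
  fixes p :: nat
  assumes p: "prime p" "odd p"
    and sq: "pcong p 1 (\<Sum>a=1..p-1. 1 / (of_nat a)\<^sup>2) 0"
  shows "pcong p 2 (\<Sum>a=1..p-1. 1 / of_nat a) 0"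
proof -
  let ?P = "of_nat p :: rat" and ?H = "\<Sum>a=1..p-1. 1 / of_nat a :: rat"
  define R :: rat where "R = (\<Sum>a=1..p-1. (1 / of_nat a)\<^sup>2 * (1 / of_nat (p - a)))"
  have inv: "1 / of_nat a \<in> p_integral p" if "a \<in> {1..p-1}" for a
    using that p by (intro p_integral_divide_nat) (auto dest: dvd_imp_le)
  have R: "R \<in> p_integral p"
    unfolding R_def
    by (intro p_integral_sum[OF p(1)] p_integral_mult[OF p(1)] p_integral_power[OF p(1)] inv) auto
  have reflect: "?H = (\<Sum>a=1..p-1. 1 / of_nat (p - a))"
    by (rule sum.reindex_bij_witness[of _ "\<lambda>a. p - a" "\<lambda>a. p - a"]) auto
  obtain z where z: "z \<in> p_integral p" "(\<Sum>a=1..p-1. 1 / (of_nat a)\<^sup>2) = ?P * z"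
    using sq p by (auto elim!: pcongE)
  have "2 * ?H = (\<Sum>a=1..p-1. 1 / of_nat a + 1 / of_nat (p - a))"
    using reflect by (simp add: sum.distrib)
  also have "\<dots> = (\<Sum>a=1..p-1. ?P * (?P * ((1 / of_nat a)\<^sup>2 * (1 / of_nat (p - a))) - 1 / (of_nat a)\<^sup>2))"
  proof (intro sum.cong refl)
    fix a assume "a \<in> {1..p-1}"
    then have "(of_nat a :: rat) \<noteq> 0" "?P - of_nat a \<noteq> 0" "of_nat (p - a) = ?P - of_nat a"
      by (auto simp: of_nat_diff)
    then show "1 / of_nat a + 1 / of_nat (p - a)
        = ?P * (?P * ((1 / of_nat a)\<^sup>2 * (1 / of_nat (p - a))) - 1 / (of_nat a)\<^sup>2)"
      by (simp add: divide_simps power2_eq_square)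
  qed
  also have "\<dots> = ?P * (?P * R - ?P * z)"
    unfolding R_def z(2)[symmetric] by (simp add: sum_distrib_left sum_subtractf right_diff_distrib)
  finally have "?H - 0 = ?P ^ 2 * ((R - z) / of_nat 2)"
    by (simp add: algebra_simps power2_eq_square)
  moreover have "(R - z) / of_nat 2 \<in> p_integral p"
    using R z p primes_dvd_imp_eq[OF p(1) two_is_prime_nat] by (intro p_integral_divide_nat) auto
  ultimately show ?thesis using p by (intro pcongI) auto
qed

text \<open>Since 15 = 3 * 5, this fails for p = 5. It serves the integrality of B_(m-2) for m - 2
  congruent to -4 modulo p - 1.\<close>

lemma not_dvd_two_power_4: "p \<ge> 7 \<Longrightarrow> prime p \<Longrightarrow> \<not> int p dvd 2 ^ 4 - 1"
proof
  assume p: "p \<ge> 7" "prime p" and "int p dvd 2 ^ 4 - 1"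
  then have "p dvd 3 * 5" using int_dvd_int_iff[of p 15] by simp
  then have "p dvd 3 \<or> p dvd 5" using p(2) prime_dvd_mult_iff by blast
  then show False using p(1) by (auto dest: dvd_imp_le)
qed

theorem theorem0p1:
  fixes p :: nat
  assumes "prime p" and "p \<ge> 7"
  shows "padic_cong p (p ^ 3)
           (of_nat (stirling p 3))
           ((of_nat p * bernoulli (p - 1) - of_nat p) * of_nat p
              * (bernoulli (p - 3) / (of_nat p - 3))
            - of_nat p ^ 2 / 2
              * (\<Sum>a = 1..p - 1. (fermat_quotient p a)\<^sup>2 / (of_nat a)\<^sup>2))"
proof -
  note p = \<open>prime p\<close>
  define P :: rat where "P = of_nat p"
  define q where "q = fermat_quotient p"
  define n where "n = p - 3"
  define S where "S m = (\<Sum>a<p. (of_nat a :: rat) ^ m)" for m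
  define H :: "nat \<Rightarrow> rat" where "H k = (\<Sum>a=1..p-1. 1 / of_nat a ^ k)" for k
  define Q where "Q = (\<Sum>a=1..p-1. (q a)\<^sup>2 / (of_nat a)\<^sup>2)"
  define R where "R = (\<Sum>a=1..p-1. (q a) ^ 3 * (1 / of_nat a)\<^sup>2)"
  define V where "V = P * bernoulli (p - 1) - P"
  define x where "x = bernoulli n / of_nat n"
  have "odd p" using assms primes_dvd_imp_eq[OF two_is_prime_nat p] by auto
  have p2: "\<not> p dvd 2" using assms by (auto dest: dvd_imp_le)
  have half: "y / 2 \<in> p_integral p" if "y \<in> p_integral p" for y
    using p_integral_divide_nat[OF p that p2] by simp
  \<comment> \<open>The form \<open>1 * (p - 1)\<close> matches the premise of
    \<open>two_power_minus_1_not_dvd\<close>, with r = 2.\<close>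
  have n: "even n" "n \<ge> 4" "n + 2 = 1 * (p - 1)" "of_nat n = P - 3"
    using assms(2) \<open>odd p\<close> by (auto simp: n_def P_def of_nat_diff)
  have P0: "P \<noteq> 0" and P: "P \<in> p_integral p" using assms(2) p by (auto simp: P_def)
  have inv: "1 / of_nat a \<in> p_integral p" if "a \<in> {1..p-1}" for a
    using that p by (intro p_integral_divide_nat) (auto dest: dvd_imp_le)
  have q: "q a \<in> p_integral p" if "a \<in> {1..p-1}" for a
    using that unfolding q_def by (intro fermat_quotient_p_integral[OF p]) (auto dest: dvd_imp_le)
  have R: "R \<in> p_integral p"
    unfolding R_def using p inv q by (auto intro!: p_integral_sum p_integral_mult p_integral_power)

  \<comment> \<open>Kummer congruences at the exponent p - 3\<close>
  have "\<not> p dvd 3" using assms(2) by (auto dest: dvd_imp_le)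
  then have not3: "\<not> int p dvd 2 ^ 2 - 1" using int_dvd_int_iff[of p 3] by simp
  have not_dvd: "\<not> int p dvd 2 ^ n - 1"
    using n(3) not3 by (rule two_power_minus_1_not_dvd[OF p \<open>odd p\<close>])
  obtain d e where d: "d \<in> p_integral p" and e: "e \<in> p_integral p"
    and b1: "bernoulli (n + (p - 1)) / of_nat (n + (p - 1)) = x + P * d"
    and b2: "bernoulli (n + 2 * (p - 1)) / of_nat (n + 2 * (p - 1)) = x + 2 * P * d + P\<^sup>2 * e"
    using kummer_second_order[OF p \<open>odd p\<close> n(1) _ not_dvd] n(2) unfolding x_def P_def
    by (metis (no_types, lifting) less_le_trans numeral_less_iff semiring_norm(76,78))
  have x: "x \<in> p_integral p"
    using bernoulli_div_p_integral[OF p \<open>odd p\<close> _ not_dvd] n(2) by (simp add: x_def)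
  have P1: "of_nat (p - 1) = P - 1" using assms(2) by (simp add: P_def of_nat_diff)
  \<comment> \<open>The factors P - 3, 2 P - 4 and 3 P - 5 are the three exponents p - 3 + j
    (p-1).\<close>
  have B0: "bernoulli n = (P - 3) * x"
    using n(2) by (simp add: x_def flip: n(4))
  have "bernoulli (n + (p - 1)) = of_nat (n + (p - 1)) * (x + P * d)"
    using n(2) by (simp flip: b1)
  then have B1: "bernoulli (n + (p - 1)) = (2 * P - 4) * (x + P * d)"
    unfolding of_nat_add of_nat_mult n(4) P1 by simp
  have "bernoulli (n + 2 * (p - 1)) = of_nat (n + 2 * (p - 1)) * (x + 2 * P * d + P\<^sup>2 * e)"
    using n(2) by (simp flip: b2)
  then have B2: "bernoulli (n + 2 * (p - 1)) = (3 * P - 5) * (x + 2 * P * d + P\<^sup>2 * e)"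
    unfolding of_nat_add of_nat_mult n(4) P1 by simp

  \<comment> \<open>Power sums modulo p^3\<close>
  have S: "\<exists>s\<in>p_integral p. S (n + k * (p - 1)) = P * bernoulli (n + k * (p - 1)) + P ^ 3 * s" for k
  proof -
    let ?m = "n + k * (p - 1)"
    have "?m - 2 + 4 = (k + 1) * (p - 1)" using n by simp
    then have "\<not> int p dvd 2 ^ (?m - 2) - 1"
      using not_dvd_two_power_4[OF assms(2) p] by (rule two_power_minus_1_not_dvd[OF p \<open>odd p\<close>])
    then have "bernoulli (?m - 2) \<in> p_integral p"
      using n(2) by (intro bernoulli_p_integral[OF p \<open>odd p\<close>]) auto
    then have "pcong p 3 (S ?m) (P * bernoulli ?m)"
      using n assms(2) \<open>odd p\<close> unfolding S_def P_def by (intro sum_powers_pcong[OF p]) auto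
    then show ?thesis using p by (auto elim!: pcongE simp: P_def)
  qed
  obtain s0 where s0: "s0 \<in> p_integral p" "S n = P * ((P - 3) * x) + P ^ 3 * s0"
    using S[of 0] B0 by auto
  obtain s1 where s1: "s1 \<in> p_integral p"
    "S (n + (p - 1)) = P * ((2 * P - 4) * (x + P * d)) + P ^ 3 * s1"
    using S[of 1] B1 by auto
  obtain s2 where s2: "s2 \<in> p_integral p"
    "S (n + 2 * (p - 1)) = P * ((3 * P - 5) * (x + 2 * P * d + P\<^sup>2 * e)) + P ^ 3 * s2"
    using S[of 2] B2 by auto
  have S_sum: "S m = (\<Sum>a=1..p-1. of_nat a ^ m)" if "m > 0" for m
    using sum_weighted_powers_lessThan[OF p that, of "\<lambda>_. 1"] by (simp add: S_def)
  \<comment> \<open>As a^(p-3) = a^(p-1)/a^2, the power sums become sums of 1/a^2 weighted by powers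
    of u_a = 1 + P q_a.\<close>
  have an: "of_nat a ^ n = (1 + P * q a) * (1 / of_nat a)\<^sup>2" if "a \<in> {1..p-1}" for a
  proof -
    have "(of_nat a :: rat) ^ n * (of_nat a)\<^sup>2 = 1 + P * q a"
      unfolding P_def q_def power_fermat_quotient[OF p, symmetric] using n(3)
      by (simp flip: power_add)
    then show ?thesis using that by (simp add: divide_simps)
  qed
  have an1: "of_nat a ^ (n + (p - 1)) = (1 + P * q a)\<^sup>2 * (1 / of_nat a)\<^sup>2" if "a \<in> {1..p-1}" for a
    unfolding power_add_fermat_quotient(1)[OF p] an[OF that]
    by (simp add: P_def q_def power2_eq_square)
  have an2: "of_nat a ^ (n + 2 * (p - 1)) = (1 + P * q a) ^ 3 * (1 / of_nat a)\<^sup>2" if "a \<in> {1..p-1}" for a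
    unfolding power_add_fermat_quotient(2)[OF p] an[OF that]
    by (simp add: P_def q_def power2_eq_square power3_eq_cube)
  have S0: "S n = (\<Sum>a=1..p-1. (1 + P * q a) * (1 / of_nat a)\<^sup>2)"
    using n(2) by (subst S_sum) (simp, rule sum.cong[OF refl an])
  have S1: "S (n + (p - 1)) = (\<Sum>a=1..p-1. (1 + P * q a)\<^sup>2 * (1 / of_nat a)\<^sup>2)"
    using n(2) by (subst S_sum) (simp, rule sum.cong[OF refl an1])
  have S2: "S (n + 2 * (p - 1)) = (\<Sum>a=1..p-1. (1 + P * q a) ^ 3 * (1 / of_nat a)\<^sup>2)"
    using n(2) by (subst S_sum) (simp, rule sum.cong[OF refl an2])

  \<comment> \<open>The sums of 1/a^2 and of q_a^2/a^2\<close>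
  have H2: "H 2 = 2 * S n - S (n + (p - 1)) + P\<^sup>2 * Q"
    unfolding H_def S0 S1 Q_def sum_distrib_left sum_subtractf[symmetric] sum.distrib[symmetric]
    by (intro sum.cong refl) (simp add: field_simps power2_eq_square)
  have SQ: "S (n + 2 * (p - 1)) - 2 * S (n + (p - 1)) + S n = P\<^sup>2 * Q + P ^ 3 * R"
    unfolding S0 S1 S2 Q_def R_def sum_distrib_left sum_subtractf[symmetric] sum.distrib[symmetric]
    by (intro sum.cong refl) (simp add: field_simps power2_eq_square power3_eq_cube)
  \<comment> \<open>In the second difference of the power sums the terms in \<open>x\<close> cancel,
    the three exponents being in arithmetic progression. What survives is -2 P^2 d, and
    \<open>k\<close> collects the rest, of order P^3, together with -R.\<close>
  define k where "k = 2 * d + (3 * P - 5) * e + s2 - 2 * s1 + s0 - R"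
  have k: "k \<in> p_integral p"
    unfolding k_def using p d e s0 s1 s2 R P by auto
  have "P\<^sup>2 * Q = P\<^sup>2 * (- 2 * d + P * k)"
    using SQ unfolding s0 s1 s2 k_def
    by (simp add: algebra_simps power2_eq_square power3_eq_cube)
  then have Q: "Q = - 2 * d + P * k" using P0 by simp
  \<comment> \<open>In 2 S(n) - S(n + p - 1) the terms in \<open>x\<close> leave -2 P x, and 4 P^2 d
    combines with the -2 P^2 d of P^2 Q; \<open>h\<close> collects the order P^3.\<close>
  define h where "h = 2 * s0 - s1 + k - 2 * d"
  have h: "h \<in> p_integral p" unfolding h_def using p d s0 s1 k by auto
  have H2': "H 2 = - 2 * P * x + 2 * P\<^sup>2 * d + P ^ 3 * h"
    unfolding H2 s0 s1 Q h_def by (simp add: algebra_simps power2_eq_square power3_eq_cube)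
  have "pcong p 1 (\<Sum>a=1..p-1. 1 / (of_nat a)\<^sup>2) 0"
  proof (rule pcongI[OF p])
    show "(\<Sum>a=1..p-1. 1 / (of_nat a)\<^sup>2) - 0 = of_nat p ^ 1 * (- 2 * x + 2 * P * d + P\<^sup>2 * h)"
      using H2' unfolding H_def by (simp add: algebra_simps power2_eq_square power3_eq_cube P_def)
    show "- 2 * x + 2 * P * d + P\<^sup>2 * h \<in> p_integral p"
      using p x d h P by (simp add: p_integral_add p_integral_mult p_integral_uminus p_integral_power)
  qed
  from wolstenholme_harmonic[OF p \<open>odd p\<close> this] obtain g where
    g: "g \<in> p_integral p" "(\<Sum>a=1..p-1. 1 / of_nat a) = P\<^sup>2 * g"
    using p by (auto elim!: pcongE simp: P_def)

  \<comment> \<open>The factorial and the Stirling number\<close>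
  obtain w where w: "w \<in> p_integral p" "fact (p - 1) = V + P\<^sup>2 * w"
    using fact_pcong_bernoulli[OF p] assms(2) p by (auto elim!: pcongE simp: P_def V_def)
  obtain f where f: "f \<in> p_integral p" "fact (p - 1) = - 1 + P * f"
  proof -
    have "pcong p 2 (fact (p - 1)) (- 1 + P * (\<Sum>a=1..p-1. q a))"
      using fact_pcong_sum_fermat_quotient[OF p \<open>odd p\<close>] by (simp add: P_def q_def)
    then obtain y where y: "y \<in> p_integral p"
      "fact (p - 1) = - 1 + P * (\<Sum>a=1..p-1. q a) + P\<^sup>2 * y"
      using p by (auto elim!: pcongE simp: P_def)
    have "(\<Sum>a=1..p-1. q a) \<in> p_integral p" using p q by (intro p_integral_sum) auto
    then show ?thesis
      using y p P by (intro that[of "(\<Sum>a=1..p-1. q a) + P * y"]) (auto simp: algebra_simps power2_eq_square)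
  qed
  \<comment> \<open>V is -1 modulo p. Hence V P^2 d, coming from \<open>H 2\<close>, and P^2 d,
    coming from \<open>Q\<close>, cancel modulo P^3.\<close>
  define v where "v = f - P * w"
  have v: "v \<in> p_integral p" "V = - 1 + P * v"
    using w f p P by (auto simp: v_def algebra_simps power2_eq_square)
  have "Suc (p - 1) = p" using assms(2) by simp
  then have St: "of_nat (stirling p 3) = (V + P\<^sup>2 * w) / 2 * ((P\<^sup>2 * g)\<^sup>2 - H 2)"
    using stirling_Suc_3[of "p - 1"] g(2) w(2) by (simp add: H_def)
  define z where "z = (V + P\<^sup>2 * w) * P * g\<^sup>2 / 2 - v * d - V * h / 2 + w * x - w * P * d - P\<^sup>2 * w * h / 2 + k / 2"
  have z: "z \<in> p_integral p"
  proof -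
    have V: "V \<in> p_integral p" using v p P by auto
    have "2 * z = (V + P\<^sup>2 * w) * P * g\<^sup>2 - 2 * v * d - V * h + 2 * w * x - 2 * w * P * d - P\<^sup>2 * w * h + k"
      by (simp add: z_def field_simps)
    also have "\<dots> \<in> p_integral p" using p P V w g v d h x k by auto
    finally show ?thesis using half[of "2 * z"] by simp
  qed
  have diff: "of_nat (stirling p 3) - (V * P * x - P\<^sup>2 / 2 * Q) = P ^ 3 * z"
  proof -
    have "V * (P\<^sup>2 * d) = - P\<^sup>2 * d + P ^ 3 * (v * d)"
      unfolding v(2) by (simp add: algebra_simps power2_eq_square power3_eq_cube)
    moreover have "of_nat (stirling p 3) - (V * P * x - P\<^sup>2 / 2 * Q)
        = P ^ 3 * ((V + P\<^sup>2 * w) * P * g\<^sup>2 / 2 - V * h / 2 + w * x - w * P * d - P\<^sup>2 * w * h / 2 + k / 2)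
          - V * (P\<^sup>2 * d) - P\<^sup>2 * d"
      unfolding St H2' Q by (simp add: field_simps power2_eq_square power3_eq_cube)
    ultimately show ?thesis unfolding z_def by (simp add: algebra_simps)
  qed
  \<comment> \<open>\<open>padic_cong\<close> also demands an integral right side; it is the integer
    \<open>stirling p 3\<close> minus P^3 z.\<close>
  have "of_nat (stirling p 3) \<in> p_integral p" using p by auto
  moreover from this have "of_nat (stirling p 3) - P ^ 3 * z \<in> p_integral p"
    using p P z by auto
  then have "V * P * x - P\<^sup>2 / 2 * Q \<in> p_integral p"
    by (simp flip: diff)
  ultimately have "padic_cong p (p ^ 3) (of_nat (stirling p 3)) (V * P * x - P\<^sup>2 / 2 * Q)"
    unfolding padic_cong_def using diff z by (auto simp: P_def)
  then show ?thesis
    using n(4) by (simp add: V_def P_def x_def n_def Q_def q_def)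
qed

end
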